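(* Let $H$ be a symmetry group on $\mathbb Z^d$ and $M$ a $d\times d$ matrix dilation with set of digits $D(M)=\{s_0,\dots,s_{m-1}\}$, $m=|\det M|$, such that $MEM^{-1}\in H$ for all $E\in H$, and for all $E\in H$ and $j=0,\dots,m-1$ one has $Es_j=Mr_j^E+s_j$ with some $r_j^E\in\mathbb Z^d$. Let $n\in\mathbb N$, $c\in\mathbb Z^d$. Let masks $m_0$ and $\widetilde m_0$ be $H$-symmetric with respect to the center $c$, let $m_0$ have sum rule of order $n$ (with respect to $M$), and let $\widetilde m_0$ satisfy $$D^\beta\big(1-m_0(\xi)\overline{\widetilde m_0(\xi)}\big)\Big|_{\xi=\mathbf 0}=0\qquad\forall\beta\in\Delta_n.$$ Then there exist wavelet masks $m_\nu$ and $\widetilde m_\nu$, $\nu=1,\dots,m$ (for $m_0,\widetilde m_0$), each of which is $H$-symmetric with respect to some point, and such that the wavelet masks $\widetilde m_\nu$, $\nu=1,\dots,m$, have vanishing moments of order $n$.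
   Context: A symmetry group on $\mathbb Z^d$ is a finite set $H$ of integer $d\times d$ matrices with $|\det E|=1$ for $E\in H$ that forms a group under matrix multiplication. A matrix dilation $M$ is an integer $d\times d$ matrix all of whose eigenvalues are bigger than 1 in modulus; $M^*$ is its conjugate (transpose). A set of digits contains exactly one representative of each coset of $\mathbb Z^d/M\mathbb Z^d$. $[\alpha]=\sum_j\alpha_j$, $\Delta_n=\{\alpha\in\mathbb Z^d_+:[\alpha]<n\}$. A trigonometric polynomial is a finite sum $t(\xi)=\sum_{k\in\mathbb Z^d}h_ke^{2\pi i(k,\xi)}$, $h_k\in\mathbb C$; a mask (refinable mask) is a trigonometric polynomial equal to 1 at $\mathbf 0$. The polyphase components $\tau_k$, $k=0,\dots,m-1$, of $t$ are the unique trigonometric polynomials with $t(\xi)=\frac1{\sqrt m}\sum_{k=0}^{m-1}e^{2\pi i(s_k,\xi)}\tau_k(M^*\xi)$. $t$ is $H$-symmetric with respect to a center $c\in\mathbb R^d$ if $c-Ec\in\mathbb Z^d$ and $t(\xi)=e^{2\pi i(c-Ec,\xi)}t(E^*\xi)$ for all $E\in H$. $t$ has sum rule of order $n$ with respect to $M$ if $D^\beta(t(M^{*-1}\xi))|_{\xi=s}=0$ for all $s\in D(M^* )\setminus\{\mathbf 0\}$, $\beta\in\Delta_n$ (where $D(M^* )$ is a set of digits of $M^*$ containing $\mathbf 0$). $t$ has vanishing moments of order $n$ if $D^\beta t(\mathbf 0)=0$ for all $\beta\in\Delta_n$. Wavelet masks: given masks $m_0,\widetilde m_0$, trigonometric polynomials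 $m_\nu,\widetilde m_\nu$, $\nu=1,\dots,m$, are called wavelet masks for $m_0,\widetilde m_0$ if the $(m+1)\times m$ matrices $\mathcal M=(\mu_{\nu k})$, $\widetilde{\mathcal M}=(\widetilde\mu_{\nu k})$, $\nu=0,\dots,m$, $k=0,\dots,m-1$, where $\mu_{\nu k}$, $\widetilde\mu_{\nu k}$ are the polyphase components of $m_\nu$, $\widetilde m_\nu$, satisfy $\mathcal M^T\overline{\widetilde{\mathcal M}}=I_m$ (mixed extension principle). *)

theory Defs
  imports "HOL-Analysis.Analysis" "HOL-Algebra.Group"
begin

abbreviation real_vec :: "int ^ 'd \<Rightarrow> real ^ 'd" where
  "real_vec k \<equiv> (\<chi> i. real_of_int (k $ i))"

abbreviation real_mat :: "int ^ 'd ^ 'd \<Rightarrow> real ^ 'd ^ 'd" where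
  "real_mat A \<equiv> map_matrix real_of_int A"

definition symmetry_group :: "(int ^ 'd ^ 'd) set \<Rightarrow> bool" where
  "symmetry_group H \<longleftrightarrow> finite H \<and> (\<forall>E\<in>H. \<bar>det E\<bar> = 1) \<and>
     group \<lparr>carrier = H, monoid.mult = (\<lambda>A B. A ** B), one = mat 1\<rparr>"

definition eigenvalue :: "complex ^ 'd ^ 'd \<Rightarrow> complex \<Rightarrow> bool" where
  "eigenvalue A z \<longleftrightarrow> (\<exists>v. v \<noteq> 0 \<and> A *v v = z *s v)"

definition matrix_dilation :: "int ^ 'd ^ 'd \<Rightarrow> bool" where
  "matrix_dilation M \<longleftrightarrow> (\<forall>z. eigenvalue (map_matrix of_int M) z \<longrightarrow> cmod z > 1)"

definition digit_set :: "int ^ 'd ^ 'd \<Rightarrow> (int ^ 'd) set \<Rightarrow> bool" where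
  "digit_set M D \<longleftrightarrow> (\<forall>x. \<exists>!s. s \<in> D \<and> (\<exists>y. x - s = M *v y))"

definition num_digits :: "int ^ 'd ^ 'd \<Rightarrow> nat" where
  "num_digits M = nat \<bar>det M\<bar>"

definition chr :: "real ^ 'd \<Rightarrow> real ^ 'd \<Rightarrow> complex" where
  "chr a \<xi> = exp (2 * of_real pi * \<i> * of_real (a \<bullet> \<xi>))"

definition trig_poly :: "(real ^ 'd \<Rightarrow> complex) \<Rightarrow> bool" where
  "trig_poly t \<longleftrightarrow>
     (\<exists>K h. finite K \<and> t = (\<lambda>\<xi>. \<Sum>k\<in>K. h k * chr (real_vec k) \<xi>))"

definition refinable_mask :: "(real ^ 'd \<Rightarrow> complex) \<Rightarrow> bool" where
  "refinable_mask t \<longleftrightarrow> trig_poly t \<and> t 0 = 1"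

text \<open>A family \<open>\<tau>\<close> satisfying this is unique on the indices below \<open>num_digits M\<close> when
  \<open>s\<close> enumerates a digit set of a nonsingular \<open>M\<close>, so ``the'' polyphase components can
  be treated relationally.  Since \<open>M\<close> is real, its conjugate is its transpose.\<close>

definition polyphase ::
  "int ^ 'd ^ 'd \<Rightarrow> (nat \<Rightarrow> int ^ 'd) \<Rightarrow> (real ^ 'd \<Rightarrow> complex) \<Rightarrow> (nat \<Rightarrow> real ^ 'd \<Rightarrow> complex) \<Rightarrow> bool" where
  "polyphase M s t \<tau> \<longleftrightarrow>
     (\<forall>k<num_digits M. trig_poly (\<tau> k)) \<and>
     (\<forall>\<xi>. t \<xi> = 1 / of_real (sqrt (real (num_digits M))) *
        (\<Sum>k<num_digits M. chr (real_vec (s k)) \<xi> * \<tau> k (transpose (real_mat M) *v \<xi>)))"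

definition H_symmetric :: "(int ^ 'd ^ 'd) set \<Rightarrow> real ^ 'd \<Rightarrow> (real ^ 'd \<Rightarrow> complex) \<Rightarrow> bool" where
  "H_symmetric H c t \<longleftrightarrow>
     (\<forall>E\<in>H. c - real_mat E *v c \<in> range real_vec \<and>
        (\<forall>\<xi>. t \<xi> = chr (c - real_mat E *v c) \<xi> * t (transpose (real_mat E) *v \<xi>)))"

definition partial_deriv :: "'d \<Rightarrow> (real ^ 'd \<Rightarrow> complex) \<Rightarrow> real ^ 'd \<Rightarrow> complex" where
  "partial_deriv j f x = vector_derivative (\<lambda>h. f (x + h *\<^sub>R axis j 1)) (at 0)"

text \<open>The mixed derivative \<open>D\<^sup>\<beta>\<close> applies the partial derivatives along a fixed but
  unspecified enumeration of the coordinates.  The order is immaterial for smooth functions, and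
  \<open>multi_deriv\<close> is only ever applied to finite sums of exponentials.\<close>

definition coords :: "'d::finite list" where
  "coords = (SOME js. distinct js \<and> set js = UNIV)"

definition multi_deriv :: "nat ^ 'd \<Rightarrow> (real ^ 'd \<Rightarrow> complex) \<Rightarrow> real ^ 'd \<Rightarrow> complex" where
  "multi_deriv \<beta> f = foldr (\<lambda>j. partial_deriv j ^^ (\<beta> $ j)) coords f"

definition multi_indices_below :: "nat \<Rightarrow> (nat ^ 'd) set" where
  "multi_indices_below n = {\<beta>. (\<Sum>j\<in>UNIV. \<beta> $ j) < n}"

definition sum_rule ::
  "int ^ 'd ^ 'd \<Rightarrow> (int ^ 'd) set \<Rightarrow> nat \<Rightarrow> (real ^ 'd \<Rightarrow> complex) \<Rightarrow> bool" where
  "sum_rule M Dstar n t \<longleftrightarrow>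
     (\<forall>s \<in> Dstar - {0}. \<forall>\<beta> \<in> multi_indices_below n.
        multi_deriv \<beta> (\<lambda>\<xi>. t (matrix_inv (transpose (real_mat M)) *v \<xi>)) (real_vec s) = 0)"

definition vanishing_moments :: "nat \<Rightarrow> (real ^ 'd \<Rightarrow> complex) \<Rightarrow> bool" where
  "vanishing_moments n t \<longleftrightarrow> (\<forall>\<beta> \<in> multi_indices_below n. multi_deriv \<beta> t 0 = 0)"

text \<open>Only the values \<open>w \<nu>\<close>, \<open>wt \<nu>\<close> for \<open>1 \<le> \<nu> \<le> num_digits M\<close> matter;
  row \<open>0\<close> of each polyphase matrix comes from the given masks.\<close>

definition wavelet_masks ::
  "int ^ 'd ^ 'd \<Rightarrow> (nat \<Rightarrow> int ^ 'd) \<Rightarrow> (real ^ 'd \<Rightarrow> complex) \<Rightarrow> (real ^ 'd \<Rightarrow> complex) \<Rightarrow>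
   (nat \<Rightarrow> real ^ 'd \<Rightarrow> complex) \<Rightarrow> (nat \<Rightarrow> real ^ 'd \<Rightarrow> complex) \<Rightarrow> bool" where
  "wavelet_masks M s m0 m0t w wt \<longleftrightarrow>
     (\<forall>\<nu>\<in>{1..num_digits M}. trig_poly (w \<nu>) \<and> trig_poly (wt \<nu>)) \<and>
     (\<exists>\<mu> \<mu>t.
        (\<forall>\<nu>\<le>num_digits M. polyphase M s ((w(0 := m0)) \<nu>) (\<mu> \<nu>) \<and>
                             polyphase M s ((wt(0 := m0t)) \<nu>) (\<mu>t \<nu>)) \<and>
        (\<forall>\<xi>. \<forall>k<num_digits M. \<forall>l<num_digits M.
           (\<Sum>\<nu>\<le>num_digits M. \<mu> \<nu> k \<xi> * cnj (\<mu>t \<nu> l \<xi>)) = (if k = l then 1 else 0)))"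

end

theory Submission
  imports Defs
begin

text \<open>
  Write \<open>e\<^sub>k\<close> for the character with frequency \<open>k\<close>, \<open>\<tau>\<^sub>k\<close> and \<open>\<tau>t\<^sub>k\<close> for the polyphase
  components of \<open>m0\<close> and \<open>m0t\<close>, and \<open>M\<^sup>*\<close> for the transpose of \<open>M\<close>.  The mixed extension
  principle asks for \<open>m\<close> further rows of two polyphase matrices.  Taking the identity matrix for
  those of the first one forces those of the second: row \<open>k\<close> must have the entries
  \<open>(if k = l then 1 else 0) - cnj \<tau>\<^sub>k * \<tau>t\<^sub>l\<close>.  The resulting masks are, up to the factor
  \<open>1 / sqrt m\<close>, the function \<open>e\<^sub>s\<close> with \<open>s = s k\<close> on the one side, and on the other
  \<open>e\<^sub>s * (1 - cnj G * m0t)\<close>, where \<open>G \<xi> = sqrt m * e\<^sub>s \<xi> * \<tau>\<^sub>k (M\<^sup>* \<xi>)\<close>.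

  So everything rests on \<open>G\<close>, which is \<open>m\<close> times the part of \<open>m0\<close> with frequencies in the coset of
  \<open>s k\<close>.  Orthogonality of the characters of the finite group of integer vectors modulo \<open>M\<^sup>*\<close>
  expresses it as a sum of translates of \<open>m0\<close> by the points \<open>y = inverse M\<^sup>* x\<close>, for the digits
  \<open>x\<close> of \<open>M\<^sup>*\<close>, with the weights \<open>cnj (e\<^sub>s y)\<close> (\<open>polyphase_component_eq_digit_average\<close>).

  Symmetry.  The hypotheses on \<open>H\<close> say that each \<open>E \<in> H\<close> maps every coset of \<open>M\<close> to itself and
  that the transpose of \<open>inverse M * E * M\<close> permutes the classes modulo \<open>M\<^sup>*\<close>.  Hence \<open>G\<close>
  inherits the centre \<open>c\<close> of \<open>m0\<close> (\<open>digit_average_symmetric\<close>).  The phases of \<open>cnj G\<close> and \<open>m0t\<close>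
  cancel, and both masks with index \<open>k\<close> are symmetric with centre \<open>s k\<close>.

  Vanishing moments.  In the sum for \<open>G\<close> the terms with \<open>x \<noteq> 0\<close> vanish at the origin to order
  \<open>n\<close> by the sum rule, and the term with \<open>x = 0\<close> is \<open>m0\<close>.  So \<open>1 - cnj G * m0t\<close> agrees to order
  \<open>n\<close> with \<open>1 - cnj m0 * m0t\<close>, which vanishes to that order by hypothesis.  Products and
  affine substitutions are awkward for the derivatives indexed by multi-indices; the argument
  therefore uses a notion of vanishing to order \<open>n\<close> in terms of all iterated directional
  derivatives, which is shown to be equivalent (\<open>vanishes_to_order_iff_multi_deriv\<close>).
\<close>

section \<open>Spans of characters\<close>

text \<open>
  The frequencies range over a set \<open>S\<close>: the integer vectors give the trigonometric polynomials,
  while \<open>S = UNIV\<close> also admits \<open>m0\<close> composed with the inverse of \<open>M\<^sup>*\<close>, whose frequencies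
  need not be integral.
\<close>

inductive char_span :: "(real ^ 'd) set \<Rightarrow> (real ^ 'd \<Rightarrow> complex) \<Rightarrow> bool"
  for S where
  char_span_zero: "char_span S (\<lambda>_. 0)"
| char_span_plus_chr:
    "a \<in> S \<Longrightarrow> char_span S f \<Longrightarrow> char_span S (\<lambda>\<xi>. b * chr a \<xi> + f \<xi>)"

lemma chr_add_freq: "chr (a + b) \<xi> = chr a \<xi> * chr b \<xi>"
  by (simp add: chr_def inner_add_left algebra_simps exp_add)

lemma chr_add_arg: "chr a (\<xi> + \<eta>) = chr a \<xi> * chr a \<eta>"
  by (simp add: chr_def inner_add_right algebra_simps exp_add)

lemma chr_zero_freq [simp]: "chr 0 \<xi> = 1"
  by (simp add: chr_def)

lemma chr_zero_arg [simp]: "chr a 0 = 1"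
  by (simp add: chr_def)

lemma cnj_chr: "cnj (chr a \<xi>) = chr (- a) \<xi>"
  by (simp add: chr_def exp_cnj)

lemma chr_uminus_mult [simp]: "chr (- a) \<xi> * chr a \<xi> = 1"
  using chr_add_freq[of "- a" a \<xi>] by simp

lemma chr_transpose: "chr a (transpose A *v \<xi>) = chr (A *v a) \<xi>"
  by (metis chr_def dot_lmul_matrix inner_commute vector_transpose_matrix transpose_transpose)

lemma char_span_chr: "a \<in> S \<Longrightarrow> char_span S (\<lambda>\<xi>. b * chr a \<xi>)"
  using char_span_plus_chr[OF _ char_span_zero] by fastforce

lemma char_span_const: "0 \<in> S \<Longrightarrow> char_span S (\<lambda>_. b)"
  using char_span_chr[of 0 S b] by simp

lemma char_span_add:
  "char_span S f \<Longrightarrow> char_span S g \<Longrightarrow> char_span S (\<lambda>\<xi>. f \<xi> + g \<xi>)"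
  by (induction rule: char_span.induct) (auto simp: add.assoc intro: char_span_plus_chr)

lemma char_span_scale: "char_span S f \<Longrightarrow> char_span S (\<lambda>\<xi>. b * f \<xi>)"
proof (induction rule: char_span.induct)
  case (char_span_plus_chr a f b')
  then show ?case
    using char_span.char_span_plus_chr[of a S "\<lambda>\<xi>. b * f \<xi>" "b * b'"]
    by (simp add: algebra_simps)
qed (simp add: char_span_zero)

lemma char_span_diff:
  "char_span S f \<Longrightarrow> char_span S g \<Longrightarrow> char_span S (\<lambda>\<xi>. f \<xi> - g \<xi>)"
  using char_span_add[OF _ char_span_scale[of S g "-1"], of f] by simp

lemma char_span_sum:
  "(\<And>i. i \<in> I \<Longrightarrow> char_span S (f i)) \<Longrightarrow> char_span S (\<lambda>\<xi>. \<Sum>i\<in>I. f i \<xi>)"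
  by (induction I rule: infinite_finite_induct) (auto intro: char_span_zero char_span_add)

lemma char_span_mult:
  assumes add: "\<And>a b. a \<in> S \<Longrightarrow> b \<in> S \<Longrightarrow> a + b \<in> S"
    and "char_span S f" "char_span S g"
  shows "char_span S (\<lambda>\<xi>. f \<xi> * g \<xi>)"
  using assms(2)
proof (induction rule: char_span.induct)
  case (char_span_plus_chr a f b)
  have "char_span S (\<lambda>\<xi>. b * chr a \<xi> * g \<xi>)"
    using assms(3)
  proof (induction rule: char_span.induct)
    case (char_span_plus_chr a' g b')
    then show ?case
      using char_span.char_span_plus_chr[of "a + a'" S "\<lambda>\<xi>. b * chr a \<xi> * g \<xi>" "b * b'"]
        add[OF \<open>a \<in> S\<close> \<open>a' \<in> S\<close>]
      by (simp add: algebra_simps chr_add_freq)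
  qed (simp add: char_span_zero)
  from char_span_add[OF this char_span_plus_chr.IH] show ?case
    by (simp add: algebra_simps)
qed (simp add: char_span_zero)

lemma char_span_cnj:
  assumes "\<And>a. a \<in> S \<Longrightarrow> - a \<in> S" and "char_span S f"
  shows "char_span S (\<lambda>\<xi>. cnj (f \<xi>))"
  using assms(2)
proof (induction rule: char_span.induct)
  case (char_span_plus_chr a f b)
  then show ?case
    using char_span.char_span_plus_chr[of "- a" S "\<lambda>\<xi>. cnj (f \<xi>)" "cnj b"] assms(1)
    by (simp add: cnj_chr)
qed (simp add: char_span_zero)

lemma char_span_UNIV_mult:
  "char_span UNIV f \<Longrightarrow> char_span UNIV g \<Longrightarrow> char_span UNIV (\<lambda>\<xi>. f \<xi> * g \<xi>)"
  by (rule char_span_mult) auto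

lemma char_span_UNIV_cnj: "char_span UNIV f \<Longrightarrow> char_span UNIV (\<lambda>\<xi>. cnj (f \<xi>))"
  by (rule char_span_cnj) auto

lemma char_span_UNIV_affine:
  assumes "char_span UNIV f"
  shows "char_span UNIV (\<lambda>\<xi>. f (A *v \<xi> + b))"
  using assms
proof (induction rule: char_span.induct)
  case (char_span_plus_chr a f b')
  have "chr a (A *v \<xi> + b) = chr a b * chr (transpose A *v a) \<xi>" for \<xi>
    using chr_transpose[of a "transpose A" \<xi>] by (simp add: chr_add_arg)
  then show ?case
    using char_span.char_span_plus_chr[OF UNIV_I char_span_plus_chr.IH, of "b' * chr a b"]
    by (simp add: algebra_simps)
qed (simp add: char_span_zero)

lemma char_span_UNIV: "char_span S f \<Longrightarrow> char_span UNIV f"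
  by (induction rule: char_span.induct) (auto intro: char_span.intros)

lemma trig_poly_iff_char_span: "trig_poly t \<longleftrightarrow> char_span (range real_vec) t"
proof
  assume "trig_poly t"
  then obtain K h where "finite K" and t: "t = (\<lambda>\<xi>. \<Sum>k\<in>K. h k * chr (real_vec k) \<xi>)"
    unfolding trig_poly_def by blast
  show "char_span (range real_vec) t"
    unfolding t by (intro char_span_sum char_span_chr) auto
next
  assume "char_span (range real_vec) t"
  then show "trig_poly t"
  proof (induction rule: char_span.induct)
    case char_span_zero
    show ?case unfolding trig_poly_def by (rule exI[of _ "{}"]) simp
  next
    case (char_span_plus_chr a f b)
    obtain k where a: "a = real_vec k" using char_span_plus_chr by blast
    obtain K h where K: "finite K" and f: "f = (\<lambda>\<xi>. \<Sum>k\<in>K. h k * chr (real_vec k) \<xi>)"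
      using char_span_plus_chr.IH unfolding trig_poly_def by blast
    define h' where "h' l = (if l = k then b else 0) + (if l \<in> K then h l else 0)" for l
    have "b * chr a \<xi> + f \<xi> = (\<Sum>l\<in>insert k K. h' l * chr (real_vec l) \<xi>)" for \<xi>
    proof -
      have "(\<Sum>l\<in>insert k K. h' l * chr (real_vec l) \<xi>)
          = (\<Sum>l\<in>insert k K. if l = k then b * chr (real_vec l) \<xi> else 0)
            + (\<Sum>l\<in>insert k K. if l \<in> K then h l * chr (real_vec l) \<xi> else 0)"
        by (subst sum.distrib[symmetric]) (auto intro!: sum.cong simp: h'_def algebra_simps)
      also have "(\<Sum>l\<in>insert k K. if l \<in> K then h l * chr (real_vec l) \<xi> else 0) = f \<xi>"
        unfolding f using K by (intro sum.mono_neutral_cong_right) auto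
      finally show ?thesis using K by (simp add: a)
    qed
    then show ?case
      unfolding trig_poly_def using K by (intro exI[of _ "insert k K"] exI[of _ h']) auto
  qed
qed

section \<open>Directional derivatives and order of vanishing\<close>

definition dir_deriv :: "real ^ 'd \<Rightarrow> (real ^ 'd \<Rightarrow> complex) \<Rightarrow> real ^ 'd \<Rightarrow> complex" where
  "dir_deriv y f x = vector_derivative (\<lambda>h. f (x + h *\<^sub>R y)) (at 0)"

lemma partial_deriv_eq: "partial_deriv j = dir_deriv (axis j 1)"
  by (simp add: partial_deriv_def dir_deriv_def fun_eq_iff)

lemma chr_has_dir_deriv:
  "((\<lambda>h. b * chr a (x + h *\<^sub>R y)) has_vector_derivative
      (2 * of_real pi * \<i> * of_real (a \<bullet> y)) * b * chr a x) (at 0)"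
proof -
  have "((\<lambda>z. b * chr a x * exp (z * (2 * of_real pi * \<i> * of_real (a \<bullet> y)))) has_field_derivative
      (2 * of_real pi * \<i> * of_real (a \<bullet> y)) * b * chr a x) (at (of_real 0))"
    by (auto intro!: derivative_eq_intros)
  from has_vector_derivative_real_field[OF this] show ?thesis
    by (simp add: chr_def inner_add_right distrib_left exp_add mult_ac)
qed

lemma char_span_has_dir_deriv:
  assumes "char_span S f"
  shows "((\<lambda>h. f (x + h *\<^sub>R y)) has_vector_derivative dir_deriv y f x) (at 0)"
proof -
  have "\<exists>D. ((\<lambda>h. f (x + h *\<^sub>R y)) has_vector_derivative D) (at 0)"
    using assms
  proof (induction rule: char_span.induct)
    case (char_span_plus_chr a f b)
    then show ?case
      using has_vector_derivative_add[OF chr_has_dir_deriv] by blast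
  qed (use has_vector_derivative_const in blast)
  then show ?thesis
    unfolding dir_deriv_def by (metis vector_derivative_at)
qed

lemma dir_deriv_eqI:
  assumes "\<And>x. ((\<lambda>h. f (x + h *\<^sub>R y)) has_vector_derivative D x) (at 0)"
  shows "dir_deriv y f = D"
  using assms by (simp add: dir_deriv_def fun_eq_iff vector_derivative_at)

lemma dir_deriv_zero: "dir_deriv y (\<lambda>_. 0) = (\<lambda>_. 0)"
  by (rule dir_deriv_eqI) simp

lemma dir_deriv_plus_chr:
  assumes "char_span S f"
  shows "dir_deriv y (\<lambda>\<xi>. b * chr a \<xi> + f \<xi>)
    = (\<lambda>\<xi>. ((2 * of_real pi * \<i> * of_real (a \<bullet> y)) * b) * chr a \<xi> + dir_deriv y f \<xi>)"
  by (rule dir_deriv_eqI)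
    (intro has_vector_derivative_add chr_has_dir_deriv char_span_has_dir_deriv[OF assms])

lemma char_span_dir_deriv: "char_span S f \<Longrightarrow> char_span S (dir_deriv y f)"
  by (induction rule: char_span.induct)
    (auto simp: dir_deriv_zero dir_deriv_plus_chr intro: char_span.intros)

lemma dir_deriv_add:
  assumes "char_span S f" "char_span S g"
  shows "dir_deriv y (\<lambda>\<xi>. f \<xi> + g \<xi>) = (\<lambda>\<xi>. dir_deriv y f \<xi> + dir_deriv y g \<xi>)"
  by (rule dir_deriv_eqI)
    (intro has_vector_derivative_add char_span_has_dir_deriv[OF assms(1)]
      char_span_has_dir_deriv[OF assms(2)])

lemma dir_deriv_mult:
  assumes "char_span S f" "char_span S g"
  shows "dir_deriv y (\<lambda>\<xi>. f \<xi> * g \<xi>) = (\<lambda>\<xi>. f \<xi> * dir_deriv y g \<xi> + dir_deriv y f \<xi> * g \<xi>)"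
  by (rule dir_deriv_eqI)
    (use has_vector_derivative_mult[OF char_span_has_dir_deriv[OF assms(1)]
        char_span_has_dir_deriv[OF assms(2)]] in simp)

lemma dir_deriv_cnj:
  assumes "char_span S f"
  shows "dir_deriv y (\<lambda>\<xi>. cnj (f \<xi>)) = (\<lambda>\<xi>. cnj (dir_deriv y f \<xi>))"
  by (rule dir_deriv_eqI) (intro has_vector_derivative_cnj char_span_has_dir_deriv[OF assms])

lemma dir_deriv_affine:
  assumes "char_span S f"
  shows "dir_deriv y (\<lambda>\<xi>. f (A *v \<xi> + b)) = (\<lambda>\<xi>. dir_deriv (A *v y) f (A *v \<xi> + b))"
  by (rule dir_deriv_eqI)
    (use char_span_has_dir_deriv[OF assms, of "A *v _ + b" "A *v y"] in
      \<open>simp add: matrix_vector_right_distrib matrix_vector_mult_scaleR add_ac\<close>)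

lemma dir_deriv_commute:
  "char_span S f \<Longrightarrow> dir_deriv y (dir_deriv z f) = dir_deriv z (dir_deriv y f)"
proof (induction rule: char_span.induct)
  case (char_span_plus_chr a f b)
  show ?case
    unfolding dir_deriv_plus_chr[OF char_span_plus_chr.hyps(2)]
      dir_deriv_plus_chr[OF char_span_dir_deriv[OF char_span_plus_chr.hyps(2)]]
      char_span_plus_chr.IH
    by (simp add: mult_ac)
qed (simp add: dir_deriv_zero)

lemma dir_deriv_coordinates:
  assumes "char_span S f"
  shows "dir_deriv y f = (\<lambda>\<xi>. \<Sum>j\<in>UNIV. of_real (y $ j) * dir_deriv (axis j 1) f \<xi>)"
  using assms
proof (induction rule: char_span.induct)
  case (char_span_plus_chr a f b)
  have "complex_of_real (a \<bullet> y) = (\<Sum>j\<in>UNIV. of_real (y $ j) * of_real (a $ j))"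
    by (simp add: inner_vec_def mult.commute)
  then show ?case
    unfolding dir_deriv_plus_chr[OF char_span_plus_chr.hyps(2)]
    by (subst char_span_plus_chr.IH)
      (simp add: inner_axis sum.distrib sum_distrib_left sum_distrib_right algebra_simps fun_eq_iff)
qed (simp add: dir_deriv_zero)

text \<open>
  Recursion along directional derivatives makes the Leibniz rule and the chain rule for affine
  maps pass directly through an induction on the order.
\<close>

primrec vanishes_to_order :: "nat \<Rightarrow> (real ^ 'd \<Rightarrow> complex) \<Rightarrow> real ^ 'd \<Rightarrow> bool" where
  "vanishes_to_order 0 f x \<longleftrightarrow> True"
| "vanishes_to_order (Suc n) f x \<longleftrightarrow> f x = 0 \<and> (\<forall>y. vanishes_to_order n (dir_deriv y f) x)"

lemma vanishes_to_order_Suc_imp: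
  "vanishes_to_order (Suc n) f x \<Longrightarrow> vanishes_to_order n f x"
  by (induction n arbitrary: f) auto

lemma vanishes_to_order_zero: "vanishes_to_order n (\<lambda>_. 0) x"
  by (induction n) (auto simp: dir_deriv_zero)

lemma vanishes_to_order_add:
  assumes "char_span S f" "char_span S g" "vanishes_to_order n f x" "vanishes_to_order n g x"
  shows "vanishes_to_order n (\<lambda>\<xi>. f \<xi> + g \<xi>) x"
  using assms
proof (induction n arbitrary: f g)
  case (Suc n)
  then show ?case
    by (simp add: dir_deriv_add[OF Suc.prems(1,2)] char_span_dir_deriv)
qed simp

lemma vanishes_to_order_mult:
  assumes "char_span UNIV f" "char_span UNIV g" "vanishes_to_order n f x"
  shows "vanishes_to_order n (\<lambda>\<xi>. f \<xi> * g \<xi>) x"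
  using assms
proof (induction n arbitrary: f g)
  case (Suc n)
  have "vanishes_to_order n (\<lambda>\<xi>. f \<xi> * dir_deriv y g \<xi>) x" for y
    using Suc.prems vanishes_to_order_Suc_imp[OF Suc.prems(3)]
    by (intro Suc.IH char_span_dir_deriv) auto
  moreover have "vanishes_to_order n (\<lambda>\<xi>. dir_deriv y f \<xi> * g \<xi>) x" for y
    using Suc.prems by (intro Suc.IH char_span_dir_deriv) auto
  ultimately show ?case
    using Suc.prems
    by (auto simp: dir_deriv_mult[OF Suc.prems(1,2)]
        intro!: vanishes_to_order_add char_span_UNIV_mult char_span_dir_deriv)
qed simp

lemma vanishes_to_order_scale:
  "char_span UNIV f \<Longrightarrow> vanishes_to_order n f x \<Longrightarrow> vanishes_to_order n (\<lambda>\<xi>. b * f \<xi>) x"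
  using vanishes_to_order_mult[of f "\<lambda>_. b" n x] by (simp add: char_span_const mult.commute)

lemma vanishes_to_order_sum:
  assumes "\<And>i. i \<in> I \<Longrightarrow> char_span S (f i)" "\<And>i. i \<in> I \<Longrightarrow> vanishes_to_order n (f i) x"
  shows "vanishes_to_order n (\<lambda>\<xi>. \<Sum>i\<in>I. f i \<xi>) x"
  using assms
  by (induction I rule: infinite_finite_induct)
    (auto intro!: vanishes_to_order_zero vanishes_to_order_add char_span_sum)

lemma vanishes_to_order_cnj:
  assumes "char_span UNIV f" "vanishes_to_order n f x"
  shows "vanishes_to_order n (\<lambda>\<xi>. cnj (f \<xi>)) x"
  using assms
  by (induction n arbitrary: f) (auto simp: dir_deriv_cnj char_span_dir_deriv)

lemma vanishes_to_order_affine: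
  assumes "char_span UNIV f" "vanishes_to_order n f (A *v x + b)"
  shows "vanishes_to_order n (\<lambda>\<xi>. f (A *v \<xi> + b)) x"
  using assms
  by (induction n arbitrary: f) (auto simp: dir_deriv_affine char_span_dir_deriv)

lemma char_span_partial_deriv: "char_span S f \<Longrightarrow> char_span S (partial_deriv j f)"
  by (simp add: partial_deriv_eq char_span_dir_deriv)

lemma char_span_partial_deriv_pow: "char_span S f \<Longrightarrow> char_span S ((partial_deriv j ^^ k) f)"
  by (induction k) (auto simp: char_span_partial_deriv)

lemma char_span_iterated_partials:
  "char_span S f \<Longrightarrow> char_span S (foldr (\<lambda>j. partial_deriv j ^^ (\<beta> j)) js f)"
  by (induction js) (auto simp: char_span_partial_deriv_pow)

lemma partial_deriv_pow_commute:
  assumes "char_span S f"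
  shows "(partial_deriv i ^^ k) (partial_deriv j f) = partial_deriv j ((partial_deriv i ^^ k) f)"
  using assms
  by (induction k)
    (auto simp: partial_deriv_eq intro!: dir_deriv_commute char_span_partial_deriv_pow
      [unfolded partial_deriv_eq])

lemma iterated_partials_commute:
  assumes "char_span S f"
  shows "foldr (\<lambda>i. partial_deriv i ^^ (\<beta> i)) js (partial_deriv j f)
    = partial_deriv j (foldr (\<lambda>i. partial_deriv i ^^ (\<beta> i)) js f)"
  by (induction js)
    (simp_all add: partial_deriv_pow_commute[OF char_span_iterated_partials[OF assms]])

lemma iterated_partials_extra:
  assumes "char_span S f" "distinct js" "j \<in> set js"
  shows "foldr (\<lambda>i. partial_deriv i ^^ ((\<beta>(j := Suc (\<beta> j))) i)) js f
    = partial_deriv j (foldr (\<lambda>i. partial_deriv i ^^ (\<beta> i)) js f)"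
  using assms(2,3)
proof (induction js)
  case (Cons i js)
  show ?case
  proof (cases "i = j")
    case True
    then have "foldr (\<lambda>i. partial_deriv i ^^ ((\<beta>(j := Suc (\<beta> j))) i)) js f
      = foldr (\<lambda>i. partial_deriv i ^^ (\<beta> i)) js f"
      using Cons.prems by (intro foldr_cong) auto
    then show ?thesis using True by simp
  next
    case False
    then show ?thesis
      using Cons partial_deriv_pow_commute[OF char_span_iterated_partials[OF assms(1)]]
      by simp
  qed
qed simp

lemma coords_distinct: "distinct (coords :: 'd::finite list)"
  and set_coords: "set (coords :: 'd::finite list) = UNIV"
proof -
  have "\<exists>js :: 'd list. distinct js \<and> set js = UNIV"
    using finite_distinct_list[of "UNIV :: 'd set"] by auto
  from someI_ex[OF this] show "distinct (coords :: 'd list)" "set (coords :: 'd list) = UNIV"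
    unfolding coords_def by blast+
qed

text \<open>
  Partial derivatives commute, so a further one can be moved to its place in the fixed
  enumeration of the coordinates, where it raises one exponent.
\<close>

lemma multi_deriv_partial_deriv:
  assumes "char_span S f"
  shows "multi_deriv \<beta> (partial_deriv j f) = multi_deriv (\<chi> i. if i = j then Suc (\<beta> $ j) else \<beta> $ i) f"
proof -
  have *: "(\<lambda>i. (\<chi> i. if i = j then Suc (\<beta> $ j) else \<beta> $ i) $ i) = ((\<lambda>i. \<beta> $ i)(j := Suc (\<beta> $ j)))"
    by auto
  have "multi_deriv (\<chi> i. if i = j then Suc (\<beta> $ j) else \<beta> $ i) f
     = foldr (\<lambda>i. partial_deriv i ^^ (((\<lambda>i. \<beta> $ i)(j := Suc (\<beta> $ j))) i)) coords f"
    unfolding multi_deriv_def * [symmetric] by simp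
  also have "\<dots> = multi_deriv \<beta> (partial_deriv j f)"
    unfolding multi_deriv_def
    by (subst iterated_partials_extra[OF assms coords_distinct])
      (simp_all add: set_coords iterated_partials_commute[OF assms])
  finally show ?thesis ..
qed

lemma vanishes_to_order_iterated_partials:
  assumes "char_span S f" "vanishes_to_order (sum_list (map \<beta> js) + n) f x"
  shows "vanishes_to_order n (foldr (\<lambda>j. partial_deriv j ^^ (\<beta> j)) js f) x"
  using assms(2)
proof (induction js arbitrary: n)
  case (Cons j js)
  have pow: "vanishes_to_order (k + n) g x \<Longrightarrow> vanishes_to_order n ((partial_deriv j ^^ k) g) x"
    for k n g
  proof (induction k arbitrary: n)
    case (Suc k)
    from Suc.IH[of "Suc n"] Suc.prems
    have "vanishes_to_order (Suc n) ((partial_deriv j ^^ k) g) x"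
      by (simp del: vanishes_to_order.simps)
    then show ?case by (simp add: partial_deriv_eq)
  qed simp
  show ?case
    using pow[OF Cons.IH[of "\<beta> j + n"]] Cons.prems by (simp add: add_ac)
qed simp

text \<open>
  From left to right, a mixed derivative is an iterated directional one.  From right to left, a
  directional derivative is a linear combination of partial derivatives, and the induction hypothesis
  applies to each of these.
\<close>

lemma vanishes_to_order_iff_multi_deriv:
  fixes f :: "real ^ 'd \<Rightarrow> complex"
  assumes "char_span UNIV f"
  shows "vanishes_to_order n f x \<longleftrightarrow> (\<forall>\<beta>\<in>multi_indices_below n. multi_deriv \<beta> f x = 0)"
proof
  assume v: "vanishes_to_order n f x"
  show "\<forall>\<beta>\<in>multi_indices_below n. multi_deriv \<beta> f x = 0"
  proof
    fix \<beta> :: "nat ^ 'd" assume "\<beta> \<in> multi_indices_below n"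
    then have lt: "(\<Sum>j\<in>UNIV. \<beta> $ j) < n" by (simp add: multi_indices_below_def)
    have len: "sum_list (map (\<lambda>j. \<beta> $ j) coords) = (\<Sum>j\<in>UNIV. \<beta> $ j)"
      by (simp add: sum_list_distinct_conv_sum_set coords_distinct set_coords)
    define k where "k = n - (\<Sum>j\<in>UNIV. \<beta> $ j) - 1"
    have n: "n = sum_list (map (\<lambda>j. \<beta> $ j) coords) + Suc k"
      using lt len by (simp add: k_def)
    from vanishes_to_order_iterated_partials[OF assms v[unfolded n]]
    show "multi_deriv \<beta> f x = 0" by (simp add: multi_deriv_def)
  qed
next
  assume "\<forall>\<beta>\<in>multi_indices_below n. multi_deriv \<beta> f x = 0"
  with assms show "vanishes_to_order n f x"
  proof (induction n arbitrary: f)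
    case (Suc n)
    have "multi_deriv 0 f = f"
    proof -
      have "foldr (\<lambda>j. partial_deriv j ^^ 0) js f = f" for js by (induction js) auto
      then show ?thesis by (simp add: multi_deriv_def)
    qed
    moreover have "(0 :: nat ^ 'd) \<in> multi_indices_below (Suc n)"
      by (simp add: multi_indices_below_def)
    ultimately have "f x = 0" using Suc.prems(2) by metis
    moreover have part: "vanishes_to_order n (dir_deriv (axis j 1) f) x" for j
      unfolding partial_deriv_eq[symmetric]
    proof (rule Suc.IH)
      show "\<forall>\<beta>\<in>multi_indices_below n. multi_deriv \<beta> (partial_deriv j f) x = 0"
      proof
        fix \<beta> :: "nat ^ 'd" assume "\<beta> \<in> multi_indices_below n"
        moreover have "(\<Sum>i\<in>UNIV. if i = j then Suc (\<beta> $ j) else \<beta> $ i) = Suc (\<Sum>i\<in>UNIV. \<beta> $ i)"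
        proof -
          have "(\<Sum>i\<in>UNIV - {j}. if i = j then Suc (\<beta> $ j) else \<beta> $ i) = (\<Sum>i\<in>UNIV - {j}. \<beta> $ i)"
            by (intro sum.cong) auto
          then show ?thesis by (simp add: sum.remove[of UNIV j])
        qed
        ultimately have "(\<chi> i. if i = j then Suc (\<beta> $ j) else \<beta> $ i) \<in> multi_indices_below (Suc n)"
          by (simp add: multi_indices_below_def)
        with Suc.prems(2) show "multi_deriv \<beta> (partial_deriv j f) x = 0"
          by (simp add: multi_deriv_partial_deriv[OF Suc.prems(1)])
      qed
    qed (simp add: char_span_partial_deriv Suc.prems)
    moreover have "vanishes_to_order n (dir_deriv y f) x" for y
      by (subst dir_deriv_coordinates[OF Suc.prems(1)])
        (intro vanishes_to_order_sum[where S = UNIV] vanishes_to_order_scale char_span_scale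
          char_span_dir_deriv Suc.prems part)
    ultimately show ?case by simp
  qed simp
qed


section \<open>Integer lattices and their digits\<close>

lemma real_vec_add: "real_vec (k + l) = real_vec k + real_vec l"
  and real_vec_diff: "real_vec (k - l) = real_vec k - real_vec l"
  and real_vec_uminus: "real_vec (- k) = - real_vec k"
  and real_vec_zero: "real_vec 0 = 0"
  by (simp_all add: vec_eq_iff)

lemma real_vec_eq_iff: "real_vec k = real_vec l \<longleftrightarrow> k = l"
  by (simp add: vec_eq_iff)

lemma real_vec_mult: "real_vec (A *v k) = real_mat A *v real_vec k"
  by (simp add: vec_eq_iff matrix_vector_mult_def)

lemma real_mat_mult: "real_mat (A ** B) = real_mat A ** real_mat B"
  by (simp add: vec_eq_iff matrix_matrix_mult_def)

lemma real_mat_transpose: "real_mat (transpose A) = transpose (real_mat A)"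
  by (simp add: vec_eq_iff transpose_def)

lemma real_mat_eq_iff: "real_mat A = real_mat B \<longleftrightarrow> A = B"
  by (simp add: vec_eq_iff)

lemma det_map_matrix_of_int:
  "det (map_matrix of_int A :: 'a::comm_ring_1 ^ 'n ^ 'n) = of_int (det A)"
  by (simp add: det_def)

lemma matrix_dilation_det_nonzero:
  fixes M :: "int ^ 'd ^ 'd"
  assumes "matrix_dilation M"
  shows "det M \<noteq> 0"
proof
  let ?A = "map_matrix of_int M :: complex ^ 'd ^ 'd"
  assume "det M = 0"
  then have "\<not> invertible ?A"
    by (simp add: invertible_det_nz det_map_matrix_of_int)
  then obtain v where "v \<noteq> 0" "?A *v v = 0"
    using matrix_left_invertible_ker[of ?A] invertible_left_inverse[of ?A] by blast
  then have "eigenvalue ?A 0" by (auto simp: eigenvalue_def)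
  then show False using assms by (force simp: matrix_dilation_def)
qed

lemma invertible_real_mat: "det M \<noteq> 0 \<Longrightarrow> invertible (real_mat M)"
  by (simp add: invertible_det_nz det_map_matrix_of_int)

lemma matrix_inv_inverse:
  assumes "invertible A"
  shows "A ** matrix_inv A = mat 1" and "matrix_inv A ** A = mat 1"
  using someI_ex[OF assms[unfolded invertible_def]] unfolding matrix_inv_def by blast+

text \<open>
  For nonsingular \<open>M\<close>, modulo the integer vectors these points form the dual group of the group of integer
  vectors modulo \<open>M\<close>.
\<close>

abbreviation dual_point :: "int ^ 'd ^ 'd \<Rightarrow> int ^ 'd \<Rightarrow> real ^ 'd" where
  "dual_point M x \<equiv> matrix_inv (transpose (real_mat M)) *v real_vec x"

lemma transpose_mult_inv:
  assumes "det M \<noteq> 0"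
  shows "transpose (real_mat M) *v (matrix_inv (transpose (real_mat M)) *v v) = v"
    and "matrix_inv (transpose (real_mat M)) *v (transpose (real_mat M) *v v) = v"
proof -
  have "invertible (transpose (real_mat M))"
    using invertible_real_mat[OF assms] by (simp add: invertible_det_nz)
  then show "transpose (real_mat M) *v (matrix_inv (transpose (real_mat M)) *v v) = v"
    and "matrix_inv (transpose (real_mat M)) *v (transpose (real_mat M) *v v) = v"
    by (simp_all add: matrix_vector_mul_assoc matrix_inv_inverse del: transpose_matrix_vector)
qed

lemma dual_point_transpose:
  assumes "det M \<noteq> 0"
  shows "dual_point M (transpose M *v y) = real_vec y"
  by (simp only: real_vec_mult real_mat_transpose transpose_mult_inv[OF assms])

lemma dual_point_add: "dual_point M (x + y) = dual_point M x + dual_point M y"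
  by (simp only: real_vec_add matrix_vector_right_distrib)

lemma chr_int_eq_1: "chr (real_vec k) (real_vec x) = 1"
proof -
  have "real_vec k \<bullet> real_vec x = of_int (\<Sum>i\<in>UNIV. k $ i * x $ i)"
    by (simp add: inner_vec_def)
  then show ?thesis
    unfolding chr_def exp_eq_1 by (auto intro!: exI[of _ "\<Sum>i\<in>UNIV. k $ i * x $ i"])
qed

text \<open>
  For nonsingular \<open>M\<close> this is the perfect pairing of the integer vectors modulo \<open>M\<close> (argument \<open>k\<close>) with those modulo the
  transpose of \<open>M\<close> (argument \<open>x\<close>), with values in the unit circle.
\<close>

definition lattice_pairing :: "int ^ 'd ^ 'd \<Rightarrow> int ^ 'd \<Rightarrow> int ^ 'd \<Rightarrow> complex" where
  "lattice_pairing M k x = chr (real_vec k) (dual_point M x)"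

lemma lattice_pairing_add_left:
  "lattice_pairing M (k + l) x = lattice_pairing M k x * lattice_pairing M l x"
  by (simp only: lattice_pairing_def real_vec_add chr_add_freq)

lemma lattice_pairing_add_right:
  "lattice_pairing M k (x + y) = lattice_pairing M k x * lattice_pairing M k y"
  by (simp only: lattice_pairing_def dual_point_add chr_add_arg)

lemma lattice_pairing_uminus: "lattice_pairing M (- k) x = cnj (lattice_pairing M k x)"
  by (simp only: lattice_pairing_def real_vec_uminus cnj_chr)

lemma lattice_pairing_range_left:
  assumes "det M \<noteq> 0"
  shows "lattice_pairing M (M *v y) x = 1"
  by (simp only: lattice_pairing_def real_vec_mult chr_transpose[symmetric]
      transpose_mult_inv[OF assms] chr_int_eq_1)

lemma lattice_pairing_range_right:
  assumes "det M \<noteq> 0"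
  shows "lattice_pairing M k (transpose M *v y) = 1"
  by (simp only: lattice_pairing_def dual_point_transpose[OF assms] chr_int_eq_1)

text \<open>
  Both sides are the exponential of \<open>2 \<pi> \<i>\<close> times the inner product of \<open>M\<^sup>-\<^sup>1 k\<close> and \<open>x\<close>.
\<close>

lemma lattice_pairing_swap:
  assumes "det M \<noteq> 0"
  shows "lattice_pairing (transpose M) x k = lattice_pairing M k x"
proof -
  let ?y = "dual_point (transpose M) k" and ?z = "dual_point M x"
  have det: "det (transpose M) \<noteq> 0" using assms by simp
  have k: "real_vec k = real_mat M *v ?y"
    using transpose_mult_inv(1)[OF det, of "real_vec k"]
    by (simp only: real_mat_transpose transpose_transpose)
  have x: "real_vec x = transpose (real_mat M) *v ?z"
    by (simp only: transpose_mult_inv[OF assms])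
  have "lattice_pairing M k x = chr ?y (transpose (real_mat M) *v ?z)"
    unfolding lattice_pairing_def chr_transpose k[symmetric] ..
  also have "\<dots> = chr (real_vec x) ?y"
    unfolding x[symmetric] by (simp only: chr_def inner_commute)
  finally show ?thesis by (simp only: lattice_pairing_def)
qed

text \<open>
  Testing against the unit vectors shows that the coordinates of \<open>M\<^sup>-\<^sup>1 k\<close> are integers.
\<close>

lemma lattice_pairing_trivial_imp_range:
  assumes "det M \<noteq> 0" and triv: "\<And>x. lattice_pairing M k x = 1"
  shows "\<exists>y. k = M *v y"
proof -
  let ?y = "dual_point (transpose M) k"
  have det: "det (transpose M) \<noteq> 0" using assms by simp
  have k: "real_vec k = real_mat M *v ?y"
    using transpose_mult_inv(1)[OF det, of "real_vec k"]
    by (simp only: real_mat_transpose transpose_transpose)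
  have "\<exists>l::int. ?y $ j = of_int l" for j
  proof -
    have "real_vec (axis j 1) \<bullet> ?y = ?y $ j"
      by (simp add: inner_vec_def axis_def if_distrib[of "\<lambda>x. x * _"] if_distrib[of real_of_int] cong: if_cong)
    moreover have "lattice_pairing (transpose M) (axis j 1) k = 1"
      by (simp only: lattice_pairing_swap[OF assms(1)] triv)
    ultimately have "exp (2 * of_real pi * \<i> * of_real (?y $ j)) = (1 :: complex)"
      by (simp only: lattice_pairing_def chr_def)
    then obtain l :: int where "2 * pi * ?y $ j = of_int (2 * l) * pi"
      unfolding exp_eq_1 by auto
    then have "?y $ j = of_int l" by simp
    then show ?thesis ..
  qed
  then obtain l where "\<And>j. ?y $ j = of_int (l j)" by metis
  then have "?y = real_vec (\<chi> j. l j)" by (simp add: vec_eq_iff)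
  with k have "real_vec k = real_vec (M *v (\<chi> j. l j))"
    by (simp only: real_vec_mult)
  then show ?thesis by (auto simp only: real_vec_eq_iff)
qed

lemma digit_set_representative:
  assumes "digit_set A D"
  obtains d y where "d \<in> D" "x = d + A *v y"
proof -
  obtain d y where "d \<in> D" "x - d = A *v y"
    using assms unfolding digit_set_def by blast
  then show thesis using that by (simp add: algebra_simps)
qed

lemma digit_set_unique:
  assumes "digit_set A D" "d \<in> D" "e \<in> D" "d - e = A *v y"
  shows "d = e"
proof -
  have "d - d = A *v 0" by simp
  then show ?thesis using assms unfolding digit_set_def by blast
qed

text \<open>
  The preimage is the adjugate of \<open>A\<close> applied to \<open>b\<close>; its entries are the numerators in
  Cramer's rule, which are integers.
\<close>

lemma det_multiple_in_range:
  fixes A :: "int ^ 'd ^ 'd"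
  assumes "det A \<noteq> 0"
  shows "\<exists>y. A *v y = det A *s b"
proof -
  define y :: "int ^ 'd" where "y = (\<chi> k. det (\<chi> i j. if j = k then b $ i else A $ i $ j))"
  have det: "det (real_mat A) \<noteq> 0" using assms by (simp add: det_map_matrix_of_int)
  define z where "z = (\<chi> k. det (\<chi> i j. if j = k then real_vec b $ i else real_mat A $ i $ j) / det (real_mat A))"
  have "det (\<chi> i j. if j = k then real_vec b $ i else real_mat A $ i $ j) = of_int (y $ k)" for k
  proof -
    have "(\<chi> i j. if j = k then real_vec b $ i else real_mat A $ i $ j)
      = real_mat (\<chi> i j. if j = k then b $ i else A $ i $ j)"
      by (simp add: vec_eq_iff)
    then show ?thesis by (simp add: y_def det_map_matrix_of_int)
  qed
  then have y: "real_vec y = det (real_mat A) *s z"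
    using det by (simp add: z_def vec_eq_iff)
  have "real_mat A *v z = real_vec b"
    using cramer[OF det, of z "real_vec b"] by (simp add: z_def)
  then have "real_vec (A *v y) = real_vec (det A *s b)"
    unfolding real_vec_mult y by (simp add: vector_scalar_commute det_map_matrix_of_int vec_eq_iff)
  then show ?thesis by (auto simp only: real_vec_eq_iff)
qed

text \<open>
  Multiples of \<open>det A\<close> lie in the range of \<open>A\<close>, so digits that agree modulo \<open>det A\<close> in every
  coordinate are equal.
\<close>

lemma digit_set_finite:
  fixes A :: "int ^ 'd ^ 'd"
  assumes "det A \<noteq> 0" "digit_set A D"
  shows "finite D"
proof (rule inj_on_finite)
  let ?f = "\<lambda>x :: int ^ 'd. \<lambda>i. x $ i mod det A"
  show "inj_on ?f D"
  proof (rule inj_onI)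
    fix x x' assume D: "x \<in> D" "x' \<in> D" and "?f x = ?f x'"
    then have "det A dvd x $ i - x' $ i" for i by (metis mod_eq_dvd_iff)
    then have "\<exists>q. x $ i - x' $ i = det A * q" for i by (auto elim: dvdE)
    then obtain q where "\<And>i. x $ i - x' $ i = det A * q i" by metis
    then have "x - x' = det A *s (\<chi> i. q i)" by (simp add: vec_eq_iff)
    moreover obtain y where "A *v y = det A *s (\<chi> i. q i)"
      using det_multiple_in_range[OF assms(1)] by blast
    ultimately have "x - x' = A *v y" by (simp only:)
    then show "x = x'" by (rule digit_set_unique[OF assms(2) D])
  qed
  show "?f ` D \<subseteq> Pi\<^sub>E UNIV (\<lambda>_. (\<lambda>x. x mod det A) ` UNIV)"
    by auto
  have "(\<lambda>x. x mod det A) ` UNIV \<subseteq> {- \<bar>det A\<bar>..\<bar>det A\<bar>}"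
  proof
    fix z assume "z \<in> (\<lambda>x. x mod det A) ` UNIV"
    then obtain x where "z = x mod det A" by blast
    with abs_mod_less[OF assms(1), of x] show "z \<in> {- \<bar>det A\<bar>..\<bar>det A\<bar>}" by auto
  qed
  then show "finite (Pi\<^sub>E (UNIV :: 'd set) (\<lambda>_. (\<lambda>x. x mod det A) ` UNIV))"
    by (intro finite_PiE) (auto intro: finite_subset)
qed

text \<open>
  A map that is injective on the finitely many classes permutes them, so it does not change a sum
  of a periodic function over representatives.
\<close>

lemma digit_sum_reindex:
  fixes f :: "int ^ 'd \<Rightarrow> complex"
  assumes "digit_set A D" "finite D"
    and periodic: "\<And>x y. f (x + A *v y) = f x"
    and inj: "\<And>x x' y. \<pi> x - \<pi> x' = A *v y \<Longrightarrow> \<exists>z. x - x' = A *v z"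
  shows "(\<Sum>x\<in>D. f (\<pi> x)) = (\<Sum>x\<in>D. f x)"
proof -
  have "\<forall>x. \<exists>d y. d \<in> D \<and> \<pi> x = d + A *v y"
    using digit_set_representative[OF assms(1)] by metis
  then obtain rep q where rep: "\<And>x. rep x \<in> D" "\<And>x. \<pi> x = rep x + A *v q x"
    by metis
  have "inj_on rep D"
  proof (rule inj_onI)
    fix x x' assume D: "x \<in> D" "x' \<in> D" and "rep x = rep x'"
    then have "\<pi> x - \<pi> x' = A *v (q x - q x')"
      by (simp add: rep(2) matrix_vector_mult_diff_distrib)
    then show "x = x'" using inj digit_set_unique[OF assms(1) D] by blast
  qed
  moreover have "rep ` D \<subseteq> D" using rep(1) by auto
  ultimately have "bij_betw rep D D"
    using endo_inj_surj[OF assms(2)] by (auto simp: bij_betw_def)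
  then have "(\<Sum>x\<in>D. f (rep x)) = (\<Sum>x\<in>D. f x)"
    by (rule sum.reindex_bij_betw)
  then show ?thesis by (simp add: rep(2) periodic)
qed

text \<open>
  The usual argument for a nontrivial character: translating the summation variable by some \<open>t\<close> with
  value different from 1 multiplies the sum by that value.
\<close>

lemma lattice_pairing_orthogonal:
  assumes "det M \<noteq> 0" "digit_set (transpose M) D"
  shows "(\<Sum>x\<in>D. lattice_pairing M k x) = (if \<exists>y. k = M *v y then of_nat (card D) else 0)"
proof (cases "\<exists>y. k = M *v y")
  case True
  then show ?thesis using assms by (auto simp: lattice_pairing_range_left)
next
  case False
  then obtain t where t: "lattice_pairing M k t \<noteq> 1"
    using lattice_pairing_trivial_imp_range[OF assms(1)] by blast
  have "finite D" using digit_set_finite[OF _ assms(2)] assms(1) by simp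
  then have "(\<Sum>x\<in>D. lattice_pairing M k (x + t)) = (\<Sum>x\<in>D. lattice_pairing M k x)"
    by (intro digit_sum_reindex[OF assms(2)])
      (auto simp: lattice_pairing_add_right lattice_pairing_range_right[OF assms(1)]
        simp del: transpose_matrix_vector)
  then show ?thesis
    using False t by (simp add: lattice_pairing_add_right flip: sum_distrib_right)
qed

text \<open>
  A finite abelian group and its dual have the same order.  Summing the pairing over both digit sets
  gives the size of one set or of the other, according to which sum is evaluated first.
\<close>

lemma card_dual_digits:
  assumes "det M \<noteq> 0" "digit_set M D" "digit_set (transpose M) D'"
  shows "card D = card D'"
proof -
  have fin: "finite D" "finite D'"
    using digit_set_finite[OF assms(1,2)] digit_set_finite[OF _ assms(3)] assms(1) by simp_all
  have one: "(\<Sum>d\<in>E. if \<exists>y. d = A *v y then b else 0) = b"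
    if E: "digit_set A E" "finite E" for A :: "int ^ 'a ^ 'a" and E and b :: complex
  proof -
    obtain d y where d: "d \<in> E" "0 = d + A *v y" using digit_set_representative[OF E(1)] by metis
    have iff: "(\<exists>y. e = A *v y) \<longleftrightarrow> e = d" if "e \<in> E" for e
    proof
      assume "\<exists>y. e = A *v y"
      then obtain z where "e = A *v z" by blast
      then have "e - d = A *v (z + y)"
        using d(2) by (simp add: matrix_vector_right_distrib algebra_simps)
      then show "e = d" using digit_set_unique[OF E(1) that d(1)] by blast
    next
      assume "e = d"
      then have "e = A *v (- y)"
        using d(2) matrix_vector_mult_diff_distrib[of A 0 y] by (simp add: add_eq_0_iff2)
      then show "\<exists>y. e = A *v y" by blast
    qed
    have "(\<Sum>e\<in>E. if \<exists>y. e = A *v y then b else 0) = (\<Sum>e\<in>E. if e = d then b else 0)"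
      by (intro sum.cong) (simp_all add: iff)
    then show ?thesis using E(2) d(1) by simp
  qed
  have "(of_nat (card D') :: complex) = (\<Sum>d\<in>D. \<Sum>x\<in>D'. lattice_pairing M d x)"
    by (simp add: lattice_pairing_orthogonal[OF assms(1,3)] one[OF assms(2) fin(1)])
  also have "\<dots> = (\<Sum>x\<in>D'. \<Sum>d\<in>D. lattice_pairing (transpose M) x d)"
    by (subst sum.swap) (simp only: lattice_pairing_swap[OF assms(1)])
  also have "\<dots> = of_nat (card D)"
    using assms(1,2)
    by (subst lattice_pairing_orthogonal) (simp_all add: one[OF assms(3) fin(2)] del: transpose_matrix_vector)
  finally show ?thesis by (simp only: of_nat_eq_iff)
qed

section \<open>Polyphase components\<close>

lemma trig_poly_mult: "trig_poly f \<Longrightarrow> trig_poly g \<Longrightarrow> trig_poly (\<lambda>\<xi>. f \<xi> * g \<xi>)"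
  unfolding trig_poly_iff_char_span
  by (rule char_span_mult) (auto simp only: real_vec_add[symmetric])

lemma trig_poly_cnj: "trig_poly f \<Longrightarrow> trig_poly (\<lambda>\<xi>. cnj (f \<xi>))"
  unfolding trig_poly_iff_char_span
  by (rule char_span_cnj) (auto simp only: real_vec_uminus[symmetric])

lemma trig_poly_diff: "trig_poly f \<Longrightarrow> trig_poly g \<Longrightarrow> trig_poly (\<lambda>\<xi>. f \<xi> - g \<xi>)"
  unfolding trig_poly_iff_char_span by (rule char_span_diff)

lemma trig_poly_chr: "trig_poly (\<lambda>\<xi>. b * chr (real_vec k) \<xi>)"
  unfolding trig_poly_iff_char_span by (rule char_span_chr) auto

lemma trig_poly_const: "trig_poly (\<lambda>_. b)"
  using trig_poly_chr[of b 0] by (simp only: real_vec_zero chr_zero_freq mult_1_right)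

lemma trig_poly_add_int:
  assumes "trig_poly f"
  shows "f (\<xi> + real_vec x) = f \<xi>"
proof -
  obtain K h where "f = (\<lambda>\<xi>. \<Sum>k\<in>K. h k * chr (real_vec k) \<xi>)"
    using assms unfolding trig_poly_def by blast
  then show ?thesis by (simp only: chr_add_arg chr_int_eq_1 mult_1_right)
qed

lemma trig_poly_transpose:
  assumes "trig_poly f"
  shows "trig_poly (\<lambda>\<xi>. f (transpose (real_mat M) *v \<xi>))"
proof -
  obtain K h where f: "f = (\<lambda>\<xi>. \<Sum>k\<in>K. h k * chr (real_vec k) \<xi>)"
    using assms unfolding trig_poly_def by blast
  show ?thesis
    unfolding f chr_transpose real_vec_mult[symmetric] trig_poly_iff_char_span
    by (intro char_span_sum char_span_chr) auto
qed

text \<open>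
  By linearity a single character suffices: its frequency \<open>k = s j + M y\<close> contributes to the
  component \<open>j\<close> only, with frequency \<open>y\<close>.
\<close>

lemma polyphase_exists:
  fixes M :: "int ^ 'd ^ 'd"
  assumes "det M \<noteq> 0" "digit_set M (s ` {..<num_digits M})" "trig_poly t"
  shows "\<exists>\<tau>. polyphase M s t \<tau>"
proof -
  let ?m = "num_digits M" and ?r = "complex_of_real (sqrt (real (num_digits M)))"
  have r: "?r \<noteq> 0" using assms(1) by (simp add: num_digits_def)
  have "char_span (range real_vec) t" using assms(3) by (simp only: trig_poly_iff_char_span)
  then show ?thesis
  proof (induction rule: char_span.induct)
    case char_span_zero
    show ?case
      by (rule exI[of _ "\<lambda>_ _. 0"]) (simp add: polyphase_def trig_poly_const)
  next
    case (char_span_plus_chr a f b)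
    obtain k where a: "a = real_vec k" using char_span_plus_chr by blast
    obtain \<tau> where \<tau>: "polyphase M s f \<tau>" using char_span_plus_chr.IH by blast
    obtain j y where j: "j < ?m" and k: "k = s j + M *v y"
      by (rule digit_set_representative[OF assms(2), of k]) (blast intro: that)
    define \<tau>' where
      "\<tau>' i \<xi> = (if i = j then ?r * b else 0) * chr (real_vec y) \<xi> + \<tau> i \<xi>" for i \<xi>
    have "trig_poly (\<tau>' i)" if "i < ?m" for i
      using \<tau> that trig_poly_chr[of "if i = j then ?r * b else 0" y]
      unfolding \<tau>'_def polyphase_def trig_poly_iff_char_span by (intro char_span_add) auto
    moreover have "b * chr a \<xi> + f \<xi> = 1 / ?r *
        (\<Sum>i<?m. chr (real_vec (s i)) \<xi> * \<tau>' i (transpose (real_mat M) *v \<xi>))" for \<xi>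
    proof -
      have "(\<Sum>i<?m. chr (real_vec (s i)) \<xi> * \<tau>' i (transpose (real_mat M) *v \<xi>))
        = (\<Sum>i<?m. (if i = j then ?r * b * (chr (real_vec (s i)) \<xi> * chr (real_vec (M *v y)) \<xi>) else 0)
            + chr (real_vec (s i)) \<xi> * \<tau> i (transpose (real_mat M) *v \<xi>))"
        by (intro sum.cong refl)
          (simp add: \<tau>'_def chr_transpose real_vec_mult algebra_simps del: transpose_matrix_vector)
      also have "\<dots> = ?r * b * chr a \<xi>
          + (\<Sum>i<?m. chr (real_vec (s i)) \<xi> * \<tau> i (transpose (real_mat M) *v \<xi>))"
      proof -
        have "chr a \<xi> = chr (real_vec (s j)) \<xi> * chr (real_vec (M *v y)) \<xi>"
          by (simp only: a k real_vec_add chr_add_freq)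
        then show ?thesis using j by (simp add: sum.distrib del: transpose_matrix_vector)
      qed
      also have "\<dots> = ?r * b * chr a \<xi> + ?r * f \<xi>"
        using \<tau> r by (simp add: polyphase_def del: transpose_matrix_vector)
      finally show ?thesis using r by (simp add: algebra_simps)
    qed
    ultimately show ?case by (auto simp: polyphase_def)
  qed
qed

text \<open>
  The projection of \<open>t\<close> to the frequencies congruent to \<open>k\<close> modulo \<open>M\<close>, scaled by the number of
  elements of \<open>D\<close>, when \<open>D\<close> is a digit set of the transpose of \<open>M\<close>.
\<close>

definition digit_average ::
    "int ^ 'd ^ 'd \<Rightarrow> (int ^ 'd) set \<Rightarrow> int ^ 'd \<Rightarrow> (real ^ 'd \<Rightarrow> complex) \<Rightarrow> real ^ 'd \<Rightarrow> complex" where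
  "digit_average M D k t \<xi> = (\<Sum>x\<in>D. cnj (lattice_pairing M k x) * t (\<xi> + dual_point M x))"

text \<open>
  A translation by a dual point multiplies the term with index \<open>l\<close> of the polyphase representation
  by \<open>lattice_pairing M (s l) x\<close>, because \<open>\<tau> l\<close> is periodic.  Orthogonality then selects the term with
  index \<open>k\<close>.
\<close>

lemma polyphase_component_eq_digit_average:
  fixes M :: "int ^ 'd ^ 'd"
  assumes "det M \<noteq> 0" "inj_on s {..<num_digits M}" "digit_set M (s ` {..<num_digits M})"
    and "digit_set (transpose M) D" "polyphase M s t \<tau>" "k < num_digits M"
  shows "of_real (sqrt (real (num_digits M))) * (chr (real_vec (s k)) \<xi> * \<tau> k (transpose (real_mat M) *v \<xi>))
    = digit_average M D (s k) t \<xi>"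
proof -
  let ?m = "num_digits M" and ?r = "complex_of_real (sqrt (real (num_digits M)))"
  let ?c = "\<lambda>l. chr (real_vec (s l)) \<xi> * \<tau> l (transpose (real_mat M) *v \<xi>)"
  have r: "?r \<noteq> 0" using assms(1) by (simp add: num_digits_def)
  have rr: "of_nat ?m = ?r * ?r"
    by (simp add: of_real_mult[symmetric] del: of_real_mult)
  have card: "card D = ?m"
    using card_dual_digits[OF assms(1,3,4)] assms(2) by (simp add: card_image)
  have shift: "t (\<xi> + dual_point M x) = 1 / ?r * (\<Sum>l<?m. ?c l * lattice_pairing M (s l) x)" for x
  proof -
    have "transpose (real_mat M) *v (\<xi> + dual_point M x) = transpose (real_mat M) *v \<xi> + real_vec x"
      by (simp only: matrix_vector_right_distrib transpose_mult_inv[OF assms(1)])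
    then have "t (\<xi> + dual_point M x) = 1 / ?r *
        (\<Sum>l<?m. chr (real_vec (s l)) (\<xi> + dual_point M x) * \<tau> l (transpose (real_mat M) *v \<xi> + real_vec x))"
      using assms(5) by (simp only: polyphase_def)
    also have "(\<Sum>l<?m. chr (real_vec (s l)) (\<xi> + dual_point M x) * \<tau> l (transpose (real_mat M) *v \<xi> + real_vec x))
        = (\<Sum>l<?m. ?c l * lattice_pairing M (s l) x)"
    proof (rule sum.cong[OF refl])
      fix l assume "l \<in> {..<?m}"
      then have "trig_poly (\<tau> l)" using assms(5) by (simp add: polyphase_def)
      from trig_poly_add_int[OF this]
      show "chr (real_vec (s l)) (\<xi> + dual_point M x) * \<tau> l (transpose (real_mat M) *v \<xi> + real_vec x)
          = ?c l * lattice_pairing M (s l) x"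
        by (simp add: chr_add_arg lattice_pairing_def del: transpose_matrix_vector)
    qed
    finally show ?thesis .
  qed
  have orth: "(\<Sum>x\<in>D. lattice_pairing M (s l - s k) x) = (if l = k then of_nat ?m else 0)"
    if "l < ?m" for l
  proof -
    have "(\<exists>y. s l - s k = M *v y) \<longleftrightarrow> l = k"
    proof
      assume "\<exists>y. s l - s k = M *v y"
      then have "s l = s k" using digit_set_unique[OF assms(3)] that assms(6) by blast
      then show "l = k" using assms(2,6) that by (simp add: inj_on_def)
    qed (auto intro: exI[of _ 0])
    then show ?thesis by (simp add: lattice_pairing_orthogonal[OF assms(1,4)] card)
  qed
  have "digit_average M D (s k) t \<xi>
      = (\<Sum>x\<in>D. \<Sum>l<?m. 1 / ?r * (?c l * lattice_pairing M (s l - s k) x))"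
    unfolding digit_average_def shift sum_distrib_left
    by (intro sum.cong refl)
      (simp only: diff_conv_add_uminus lattice_pairing_add_left lattice_pairing_uminus mult_ac)
  also have "\<dots> = (\<Sum>l<?m. 1 / ?r * (?c l * (\<Sum>x\<in>D. lattice_pairing M (s l - s k) x)))"
    by (subst sum.swap) (simp only: sum_distrib_left)
  also have "\<dots> = (\<Sum>l<?m. if l = k then 1 / ?r * (?c l * of_nat ?m) else 0)"
    by (intro sum.cong refl) (simp add: orth del: transpose_matrix_vector)
  also have "\<dots> = ?r * ?c k"
    using assms(6) r unfolding rr by (simp del: transpose_matrix_vector)
  finally show ?thesis ..
qed

section \<open>Symmetry of the polyphase parts\<close>

lemma symmetry_group_inverse:
  assumes "symmetry_group H" "E \<in> H"
  obtains E' where "E' \<in> H" "E' ** E = mat 1" "E ** E' = mat 1"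
proof -
  let ?G = "\<lparr>carrier = H, monoid.mult = (\<lambda>A B. A ** B), one = mat 1\<rparr>"
  have G: "group ?G" using assms(1) by (simp add: symmetry_group_def)
  have "E \<in> carrier ?G" using assms(2) by simp
  then have "inv\<^bsub>?G\<^esub> E \<in> H" "inv\<^bsub>?G\<^esub> E ** E = mat 1" "E ** inv\<^bsub>?G\<^esub> E = mat 1"
    using group.inv_closed[OF G] group.l_inv[OF G] group.r_inv[OF G] by force+
  then show thesis by (rule that)
qed

text \<open>
  The hypothesis provides conjugation by \<open>M\<close> as a map from \<open>H\<close> to itself.  It is injective, hence a
  bijection of the finite set \<open>H\<close>, so conjugation by the inverse of \<open>M\<close> preserves \<open>H\<close> as well.
\<close>

lemma conjugate_in_symmetry_group:
  assumes "symmetry_group H" "det M \<noteq> 0"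
    and conj: "\<forall>E\<in>H. real_mat M ** real_mat E ** matrix_inv (real_mat M) \<in> real_mat ` H"
    and "E \<in> H"
  obtains F where "F \<in> H" "E ** M = M ** F"
proof -
  have inv: "invertible (real_mat M)" by (rule invertible_real_mat[OF assms(2)])
  have "\<exists>F\<in>H. M ** E = F ** M" if "E \<in> H" for E
  proof -
    obtain F where F: "F \<in> H" "real_mat M ** real_mat E ** matrix_inv (real_mat M) = real_mat F"
      using conj \<open>E \<in> H\<close> by blast
    have "real_mat (F ** M) = real_mat M ** real_mat E ** (matrix_inv (real_mat M) ** real_mat M)"
      by (simp only: real_mat_mult F(2)[symmetric] matrix_mul_assoc)
    also have "\<dots> = real_mat (M ** E)"
      by (simp only: matrix_inv_inverse(2)[OF inv] matrix_mul_rid real_mat_mult)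
    finally show ?thesis using F(1) real_mat_eq_iff by metis
  qed
  then obtain \<phi> where \<phi>: "\<And>E. E \<in> H \<Longrightarrow> \<phi> E \<in> H" "\<And>E. E \<in> H \<Longrightarrow> M ** E = \<phi> E ** M"
    by metis
  have "inj_on \<phi> H"
  proof (rule inj_onI)
    fix E F assume "E \<in> H" "F \<in> H" "\<phi> E = \<phi> F"
    then have "real_mat (M ** E) = real_mat (M ** F)" by (simp add: \<phi>(2))
    then have "matrix_inv (real_mat M) ** real_mat M ** real_mat E
        = matrix_inv (real_mat M) ** real_mat M ** real_mat F"
      by (simp only: real_mat_mult matrix_mul_assoc[symmetric])
    then show "E = F" by (simp only: matrix_inv_inverse(2)[OF inv] matrix_mul_lid real_mat_eq_iff)
  qed
  moreover have "finite H" using assms(1) by (simp add: symmetry_group_def)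
  ultimately have "\<phi> ` H = H" using endo_inj_surj[of H \<phi>] \<phi>(1) by blast
  then obtain F where "F \<in> H" "E = \<phi> F" using \<open>E \<in> H\<close> by blast
  then show thesis using that \<phi>(2) by simp
qed

text \<open>
  The symmetry of \<open>t\<close> turns the term with index \<open>x\<close> at \<open>\<xi>\<close> into the one with index \<open>transpose F *v x\<close> at
  the transformed point, and \<open>transpose F\<close> permutes the classes modulo \<open>transpose M\<close>.  The phase factor
  is constant along the dual points because its frequency lies in the range of \<open>M\<close>.
\<close>

lemma digit_average_symmetric:
  assumes "det M \<noteq> 0" "digit_set (transpose M) D" "trig_poly t"
    and EF: "E ** M = M ** F" "E' ** E = mat 1" "F ** F' = mat 1"
    and k: "E *v k = M *v r + k"
    and sym: "\<And>\<xi>. t \<xi> = chr (real_vec (M *v b)) \<xi> * t (transpose (real_mat E) *v \<xi>)"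
  shows "digit_average M D k t \<xi>
    = chr (real_vec (M *v b)) \<xi> * digit_average M D k t (transpose (real_mat E) *v \<xi>)"
proof -
  define f where
    "f x = cnj (lattice_pairing M k x) * t (transpose (real_mat E) *v \<xi> + dual_point M x)" for x
  have F_dual: "dual_point M (transpose F *v x) = transpose (real_mat E) *v dual_point M x" for x
  proof -
    have "transpose (real_mat M) *v (transpose (real_mat E) *v dual_point M x)
        = transpose (real_mat (E ** M)) *v dual_point M x"
      by (simp only: matrix_vector_mul_assoc matrix_mul_assoc real_mat_mult matrix_transpose_mul)
    also have "\<dots> = transpose (real_mat F) *v (transpose (real_mat M) *v dual_point M x)"
      by (simp only: EF(1) matrix_vector_mul_assoc matrix_mul_assoc real_mat_mult matrix_transpose_mul)
    also have "\<dots> = real_vec (transpose F *v x)"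
      by (simp only: transpose_mult_inv[OF assms(1)] real_vec_mult real_mat_transpose)
    finally show ?thesis by (metis transpose_mult_inv(2)[OF assms(1)])
  qed
  \<comment> \<open>This relation makes the inverse of \<open>transpose F\<close> respect the classes modulo \<open>transpose M\<close>.\<close>
  have "M ** F' = E' ** E ** M ** F'" by (simp add: EF(2))
  also have "\<dots> = E' ** (E ** M) ** F'" by (simp only: matrix_mul_assoc)
  also have "\<dots> = E' ** M ** (F ** F')" by (simp only: EF(1) matrix_mul_assoc)
  finally have MF': "M ** F' = E' ** M" by (simp add: EF(3))
  have "(\<Sum>x\<in>D. f (transpose F *v x)) = (\<Sum>x\<in>D. f x)"
  proof (rule digit_sum_reindex[OF assms(2)])
    show "finite D" using digit_set_finite[OF _ assms(2)] assms(1) by simp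
    show "f (x + transpose M *v y) = f x" for x y
      unfolding f_def lattice_pairing_add_right lattice_pairing_range_right[OF assms(1)]
        dual_point_add dual_point_transpose[OF assms(1)] add.assoc[symmetric]
        trig_poly_add_int[OF assms(3)]
      by simp
    fix x x' y assume eq: "transpose F *v x - transpose F *v x' = transpose M *v y"
    have "x - x' = transpose (F ** F') *v (x - x')" by (simp add: EF(3))
    also have "\<dots> = transpose F' *v (transpose F *v (x - x'))"
      by (simp only: matrix_vector_mul_assoc matrix_transpose_mul)
    also have "\<dots> = transpose F' *v (transpose M *v y)"
      by (simp only: matrix_vector_mult_diff_distrib eq)
    also have "\<dots> = transpose (M ** F') *v y"
      by (simp only: matrix_vector_mul_assoc matrix_transpose_mul)
    also have "\<dots> = transpose M *v (transpose E' *v y)"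
      by (simp only: MF' matrix_vector_mul_assoc matrix_transpose_mul)
    finally show "\<exists>z. x - x' = transpose M *v z" by blast
  qed
  moreover have "cnj (lattice_pairing M k x) * t (\<xi> + dual_point M x)
      = chr (real_vec (M *v b)) \<xi> * f (transpose F *v x)" for x
  proof -
    have "lattice_pairing M k (transpose F *v x) = lattice_pairing M (E *v k) x"
      unfolding lattice_pairing_def F_dual by (simp only: chr_transpose real_vec_mult)
    also have "\<dots> = lattice_pairing M k x"
      by (simp only: k lattice_pairing_add_left lattice_pairing_range_left[OF assms(1)] mult_1_left)
    finally have pair: "lattice_pairing M k (transpose F *v x) = lattice_pairing M k x" .
    have "t (\<xi> + dual_point M x) = chr (real_vec (M *v b)) (\<xi> + dual_point M x)
        * t (transpose (real_mat E) *v (\<xi> + dual_point M x))"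
      by (rule sym)
    also have "chr (real_vec (M *v b)) (\<xi> + dual_point M x) = chr (real_vec (M *v b)) \<xi>"
      using lattice_pairing_range_left[OF assms(1), of b x]
      by (simp only: chr_add_arg lattice_pairing_def mult_1_right)
    finally show ?thesis
      unfolding f_def pair F_dual matrix_vector_right_distrib by (simp only: mult_ac)
  qed
  ultimately show ?thesis
    by (simp only: digit_average_def f_def[symmetric] sum_distrib_left[symmetric])
qed

section \<open>Construction of the wavelet masks\<close>
theorem theorem30:
  fixes H :: "(int ^ 'd ^ 'd) set"
    and M :: "int ^ 'd ^ 'd"
    and s :: "nat \<Rightarrow> int ^ 'd"
    and Dstar :: "(int ^ 'd) set"
    and n :: nat
    and c :: "int ^ 'd"
    and m0 m0t :: "real ^ 'd \<Rightarrow> complex"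
  assumes "symmetry_group H"
    and "matrix_dilation M"
    and "inj_on s {..<num_digits M}"
    and "digit_set M (s ` {..<num_digits M})"
    and "\<forall>E\<in>H. real_mat M ** real_mat E ** matrix_inv (real_mat M) \<in> real_mat ` H"
    and "\<forall>E\<in>H. \<forall>j<num_digits M. \<exists>r :: int ^ 'd. E *v s j = M *v r + s j"
    and "digit_set (transpose M) Dstar" and "0 \<in> Dstar"
    and "0 < n"
    and "refinable_mask m0" and "refinable_mask m0t"
    and "H_symmetric H (real_vec c) m0" and "H_symmetric H (real_vec c) m0t"
    and "sum_rule M Dstar n m0"
    and "\<forall>\<beta> \<in> multi_indices_below n. multi_deriv \<beta> (\<lambda>\<xi>. 1 - m0 \<xi> * cnj (m0t \<xi>)) 0 = 0"
  shows "\<exists>w wt. wavelet_masks M s m0 m0t w wt \<and>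
           (\<forall>\<nu>\<in>{1..num_digits M}.
              (\<exists>a. H_symmetric H a (w \<nu>)) \<and> (\<exists>a. H_symmetric H a (wt \<nu>)) \<and>
              vanishing_moments n (wt \<nu>))"
proof -
  let ?m = "num_digits M" and ?r = "complex_of_real (sqrt (real (num_digits M)))"
  note H = assms(1) and inj = assms(3) and digits = assms(4) and dual = assms(7)
  have det: "det M \<noteq> 0" using assms(2) by (rule matrix_dilation_det_nonzero)
  have r: "?r \<noteq> 0" using det by (simp add: num_digits_def)
  have m0: "trig_poly m0" and m0t: "trig_poly m0t"
    using assms(10,11) by (auto simp: refinable_mask_def)
  obtain \<tau> \<tau>t where \<tau>: "polyphase M s m0 \<tau>" and \<tau>t: "polyphase M s m0t \<tau>t"
    using polyphase_exists[OF det digits] m0 m0t by blast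
  \<comment> \<open>Row \<open>0\<close> holds the given masks, so the digits \<open>s 0, s 1, ...\<close> belong to the rows \<open>1, 2, ...\<close>.\<close>
  define w where "w \<nu> \<xi> = 1 / ?r * chr (real_vec (s (\<nu> - 1))) \<xi>" for \<nu> \<xi>
  define wt where "wt \<nu> \<xi> = 1 / ?r * chr (real_vec (s (\<nu> - 1))) \<xi>
    - cnj (\<tau> (\<nu> - 1) (transpose (real_mat M) *v \<xi>)) * m0t \<xi>" for \<nu> \<xi>
  define \<mu> where "\<mu> \<nu> = (if \<nu> = 0 then \<tau> else (\<lambda>k _. if k = \<nu> - 1 then 1 else 0))" for \<nu>
  define \<mu>t where "\<mu>t \<nu> = (if \<nu> = 0 then \<tau>t else
    (\<lambda>l \<xi>. (if l = \<nu> - 1 then 1 else 0) - cnj (\<tau> (\<nu> - 1) \<xi>) * \<tau>t l \<xi>))" for \<nu>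

  have trig_\<tau>: "trig_poly (\<tau> k)" "trig_poly (\<tau>t k)" if "k < ?m" for k
    using \<tau> \<tau>t that by (auto simp: polyphase_def)
  have trig_w: "trig_poly (w \<nu>)" for \<nu>
    unfolding w_def by (rule trig_poly_chr)
  have trig_wt: "trig_poly (wt \<nu>)" if "\<nu> \<in> {1..?m}" for \<nu>
    unfolding wt_def using that
    by (intro trig_poly_diff trig_poly_chr trig_poly_mult trig_poly_cnj trig_poly_transpose trig_\<tau> m0t)
      auto

  have "wavelet_masks M s m0 m0t w wt"
    unfolding wavelet_masks_def
  proof (rule conjI[OF _ exI[of _ \<mu>, OF exI[of _ \<mu>t]]]; intro conjI allI impI ballI)
    fix \<nu> assume "\<nu> \<le> ?m"
    show "polyphase M s ((w(0 := m0)) \<nu>) (\<mu> \<nu>)"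
    proof (cases "\<nu> = 0")
      case False
      then have "\<nu> - 1 < ?m" using \<open>\<nu> \<le> ?m\<close> by simp
      then show ?thesis
        using False unfolding polyphase_def \<mu>_def w_def
        by (auto simp: trig_poly_const if_distrib[of "\<lambda>x. _ * x"] cong: if_cong)
    qed (simp add: \<mu>_def \<tau>)
    show "polyphase M s ((wt(0 := m0t)) \<nu>) (\<mu>t \<nu>)"
    proof (cases "\<nu> = 0")
      case False
      then have \<nu>: "\<nu> - 1 < ?m" using \<open>\<nu> \<le> ?m\<close> by simp
      have trig: "trig_poly (\<mu>t \<nu> l)" if "l < ?m" for l
        unfolding \<mu>t_def if_not_P[OF False]
        by (intro trig_poly_diff trig_poly_const trig_poly_mult trig_poly_cnj trig_\<tau> \<nu> that)
      have "wt \<nu> \<xi> = 1 / ?r *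
          (\<Sum>l<?m. chr (real_vec (s l)) \<xi> * \<mu>t \<nu> l (transpose (real_mat M) *v \<xi>))" for \<xi>
      proof -
        let ?y = "transpose (real_mat M) *v \<xi>"
        have "(\<Sum>l<?m. chr (real_vec (s l)) \<xi> * \<mu>t \<nu> l ?y)
          = (\<Sum>l<?m. (if l = \<nu> - 1 then chr (real_vec (s l)) \<xi> else 0)
              - cnj (\<tau> (\<nu> - 1) ?y) * (chr (real_vec (s l)) \<xi> * \<tau>t l ?y))"
          using False by (intro sum.cong refl)
            (simp add: \<mu>t_def algebra_simps del: transpose_matrix_vector)
        also have "\<dots> = chr (real_vec (s (\<nu> - 1))) \<xi>
            - cnj (\<tau> (\<nu> - 1) ?y) * (\<Sum>l<?m. chr (real_vec (s l)) \<xi> * \<tau>t l ?y)"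
          using \<nu> by (simp add: sum_subtractf sum_distrib_left del: transpose_matrix_vector)
        also have "(\<Sum>l<?m. chr (real_vec (s l)) \<xi> * \<tau>t l ?y) = ?r * m0t \<xi>"
          using \<tau>t r by (simp add: polyphase_def del: transpose_matrix_vector)
        finally have "(\<Sum>l<?m. chr (real_vec (s l)) \<xi> * \<mu>t \<nu> l ?y)
          = chr (real_vec (s (\<nu> - 1))) \<xi> - cnj (\<tau> (\<nu> - 1) ?y) * (?r * m0t \<xi>)" .
        then show ?thesis
          unfolding wt_def using r by (simp only:) (simp add: field_simps del: transpose_matrix_vector)
      qed
      then show ?thesis using False trig by (auto simp: polyphase_def)
    qed (simp add: \<mu>t_def \<tau>t)
  next
    fix \<xi> k l assume kl: "k < ?m" "l < ?m"
    have "(\<Sum>\<nu>\<le>?m. \<mu> \<nu> k \<xi> * cnj (\<mu>t \<nu> l \<xi>))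
        = \<tau> k \<xi> * cnj (\<tau>t l \<xi>) + (\<Sum>\<nu><?m. \<mu> (Suc \<nu>) k \<xi> * cnj (\<mu>t (Suc \<nu>) l \<xi>))"
      by (simp add: sum.atMost_shift \<mu>_def \<mu>t_def)
    also have "(\<Sum>\<nu><?m. \<mu> (Suc \<nu>) k \<xi> * cnj (\<mu>t (Suc \<nu>) l \<xi>))
        = (\<Sum>\<nu><?m. if \<nu> = k then (if k = l then 1 else 0) - \<tau> k \<xi> * cnj (\<tau>t l \<xi>) else 0)"
      by (intro sum.cong refl) (auto simp: \<mu>_def \<mu>t_def)
    also have "\<dots> = (if k = l then 1 else 0) - \<tau> k \<xi> * cnj (\<tau>t l \<xi>)"
      using kl by simp
    finally show "(\<Sum>\<nu>\<le>?m. \<mu> \<nu> k \<xi> * cnj (\<mu>t \<nu> l \<xi>)) = (if k = l then 1 else 0)"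
      by simp
  qed (auto simp: trig_w trig_wt)

  moreover have "(\<exists>a. H_symmetric H a (w \<nu>)) \<and> (\<exists>a. H_symmetric H a (wt \<nu>)) \<and>
      vanishing_moments n (wt \<nu>)" if \<nu>: "\<nu> \<in> {1..?m}" for \<nu>
  proof -
    define k where "k = \<nu> - 1"
    have k: "k < ?m" using \<nu> by (auto simp: k_def)
    let ?G = "digit_average M Dstar (s k) m0"
    have wt_eq: "wt \<nu> \<xi> = 1 / ?r * (chr (real_vec (s k)) \<xi> * (1 - cnj (?G \<xi>) * m0t \<xi>))" for \<xi>
    proof -
      have "cnj (?G \<xi>) = ?r * (chr (- real_vec (s k)) \<xi> * cnj (\<tau> k (transpose (real_mat M) *v \<xi>)))"
        using polyphase_component_eq_digit_average[OF det inj digits dual \<tau> k, of \<xi>, symmetric]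
        by (simp add: cnj_chr del: transpose_matrix_vector)
      then have "chr (real_vec (s k)) \<xi> * cnj (?G \<xi>)
          = ?r * (chr (- real_vec (s k)) \<xi> * chr (real_vec (s k)) \<xi>) * cnj (\<tau> k (transpose (real_mat M) *v \<xi>))"
        by (simp only: mult_ac)
      then have "chr (real_vec (s k)) \<xi> * cnj (?G \<xi>) = ?r * cnj (\<tau> k (transpose (real_mat M) *v \<xi>))"
        by (simp only: chr_uminus_mult mult_1_right)
      then show ?thesis
        using r by (simp add: wt_def k_def right_diff_distrib mult.assoc[symmetric] del: transpose_matrix_vector)
    qed

    have centre: "real_vec l - real_mat E *v real_vec l = real_vec (l - E *v l)" for l E
      by (simp only: real_vec_diff real_vec_mult)
    have chr_centre: "chr (real_vec (s k - E *v s k)) \<xi> * chr (real_vec (s k)) (transpose (real_mat E) *v \<xi>)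
        = chr (real_vec (s k)) \<xi>" for E \<xi>
      by (simp only: chr_transpose real_vec_mult[symmetric] chr_add_freq[symmetric]
          real_vec_add[symmetric] diff_add_cancel)
    have "H_symmetric H (real_vec (s k)) (w \<nu>)"
      unfolding H_symmetric_def centre w_def k_def[symmetric]
    proof (intro ballI conjI allI)
      fix E \<xi>
      show "1 / ?r * chr (real_vec (s k)) \<xi> = chr (real_vec (s k - E *v s k)) \<xi>
          * (1 / ?r * chr (real_vec (s k)) (transpose (real_mat E) *v \<xi>))"
        by (simp only: chr_centre[of E \<xi>, symmetric] mult_ac)
    qed (rule rangeI)
    moreover have "H_symmetric H (real_vec (s k)) (wt \<nu>)"
      unfolding H_symmetric_def centre
    proof (intro ballI conjI allI)
      fix E \<xi> assume E: "E \<in> H"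
      obtain F where F: "F \<in> H" "E ** M = M ** F"
        using conjugate_in_symmetry_group[OF H det assms(5) E] .
      obtain E' where E': "E' ** E = mat 1" using symmetry_group_inverse[OF H E] .
      obtain F' where F': "F ** F' = mat 1" using symmetry_group_inverse[OF H F(1)] .
      obtain j \<gamma> where j: "j < ?m" and c: "c = s j + M *v \<gamma>"
        by (rule digit_set_representative[OF digits, of c]) (blast intro: that)
      obtain q where q: "E *v s j = M *v q + s j" using assms(6) E j by blast
      obtain q' where q': "E *v s k = M *v q' + s k" using assms(6) E k by blast
      have "E *v (M *v \<gamma>) = M *v (F *v \<gamma>)"
        by (simp only: matrix_vector_mul_assoc F(2))
      \<comment> \<open>\<open>E\<close> preserves the coset of \<open>c\<close>, as it fixes the class of the digit and the range of \<open>M\<close>.\<close>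
      then have b: "c - E *v c = M *v (\<gamma> - F *v \<gamma> - q)"
        unfolding c matrix_vector_right_distrib matrix_vector_mult_diff_distrib q by simp
      let ?a = "real_vec (c - E *v c)" and ?E = "transpose (real_mat E) *v \<xi>"
      have sym: "m0 \<xi> = chr ?a \<xi> * m0 (transpose (real_mat E) *v \<xi>)"
        "m0t \<xi> = chr ?a \<xi> * m0t (transpose (real_mat E) *v \<xi>)" for \<xi>
        using assms(12,13) E unfolding H_symmetric_def centre by blast+
      have "?G \<xi> = chr ?a \<xi> * ?G ?E"
        unfolding b using digit_average_symmetric[OF det dual m0 F(2) E' F' q'] sym(1)[unfolded b]
        by blast
      then have "cnj (?G \<xi>) * m0t \<xi> = chr (- ?a) \<xi> * chr ?a \<xi> * (cnj (?G ?E) * m0t ?E)"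
        using sym(2)[of \<xi>] by (simp add: cnj_chr del: transpose_matrix_vector chr_uminus_mult)
      then have "cnj (?G \<xi>) * m0t \<xi> = cnj (?G ?E) * m0t ?E"
        by (simp only: chr_uminus_mult mult_1_left)
      then show "wt \<nu> \<xi> = chr (real_vec (s k - E *v s k)) \<xi> * wt \<nu> ?E"
        unfolding wt_eq by (simp only: chr_centre[of E \<xi>, symmetric] mult_ac)
    qed (rule rangeI)
    moreover have "vanishing_moments n (wt \<nu>)"
    proof -
      let ?f = "\<lambda>\<xi>. 1 - m0 \<xi> * cnj (m0t \<xi>)"
      let ?h = "\<lambda>x \<xi>. lattice_pairing M (s k) x * (cnj (m0 (\<xi> + dual_point M x)) * m0t \<xi>)"
      have span: "char_span UNIV m0" "char_span UNIV m0t"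
        using m0 m0t char_span_UNIV by (auto simp: trig_poly_iff_char_span)
      have span_shift: "char_span UNIV (\<lambda>\<xi>. m0 (\<xi> + b))" for b
        using char_span_UNIV_affine[OF span(1), of "mat 1" b] by simp
      have span_f: "char_span UNIV ?f"
        by (intro char_span_diff char_span_const char_span_UNIV_mult char_span_UNIV_cnj span) auto
      have span_h: "char_span UNIV (\<lambda>\<xi>. - ?h x \<xi>)" for x
        using char_span_scale[OF char_span_UNIV_mult[OF char_span_UNIV_cnj
            [OF span_shift[of "dual_point M x"]] span(2)], of "- lattice_pairing M (s k) x"]
        by simp
      have "finite Dstar" using digit_set_finite[OF _ dual] det by simp
      have "1 - cnj (?G \<xi>) * m0t \<xi> = cnj (?f \<xi>) + (\<Sum>x\<in>Dstar - {0}. - ?h x \<xi>)" for \<xi>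
      proof -
        have "cnj (?G \<xi>) * m0t \<xi> = (\<Sum>x\<in>Dstar. ?h x \<xi>)"
          by (simp add: digit_average_def sum_distrib_right mult.assoc)
        also have "\<dots> = ?h 0 \<xi> + (\<Sum>x\<in>Dstar - {0}. ?h x \<xi>)"
          using sum.remove[OF \<open>finite Dstar\<close> assms(8)] .
        also have "?h 0 \<xi> = cnj (m0 \<xi>) * m0t \<xi>"
          by (simp only: lattice_pairing_def real_vec_zero matrix_vector_mult_0_right
              chr_zero_arg mult_1_left add_0_right)
        finally show ?thesis by (simp add: sum_negf)
      qed
      then have wt_sum: "wt \<nu> = (\<lambda>\<xi>. (cnj (?f \<xi>) + (\<Sum>x\<in>Dstar - {0}. - ?h x \<xi>))
          * (1 / ?r * chr (real_vec (s k)) \<xi>))"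
        by (auto simp: wt_eq fun_eq_iff simp del: complex_cnj_diff complex_cnj_mult)
      have "vanishes_to_order n ?f 0"
        using assms(15) vanishes_to_order_iff_multi_deriv[OF span_f] by blast
      moreover have "vanishes_to_order n (\<lambda>\<xi>. - ?h x \<xi>) 0" if x: "x \<in> Dstar - {0}" for x
      proof -
        let ?B = "matrix_inv (transpose (real_mat M))"
        have spanB: "char_span UNIV (\<lambda>\<xi>. m0 (?B *v \<xi>))"
          using char_span_UNIV_affine[OF span(1), of ?B 0] by simp
        have "vanishes_to_order n (\<lambda>\<xi>. m0 (?B *v \<xi>)) (real_vec x)"
          using assms(14) x vanishes_to_order_iff_multi_deriv[OF spanB]
          unfolding sum_rule_def by blast
        \<comment> \<open>The sum rule concerns the point \<open>x\<close> of a rescaled mask; undoing the rescaling turns it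
          into a statement on a translate of \<open>m0\<close> at the origin.\<close>
        then have "vanishes_to_order n
            (\<lambda>\<xi>. m0 (?B *v (transpose (real_mat M) *v \<xi> + real_vec x))) 0"
          by (intro vanishes_to_order_affine[OF spanB]) simp
        then have "vanishes_to_order n (\<lambda>\<xi>. m0 (\<xi> + dual_point M x)) 0"
          by (simp only: matrix_vector_right_distrib transpose_mult_inv[OF det])
        from vanishes_to_order_mult[OF _ char_span_scale[OF span(2)]
            vanishes_to_order_cnj[OF span_shift this], of "- lattice_pairing M (s k) x"]
        show ?thesis
          using char_span_UNIV_cnj[OF span_shift] by (simp add: mult_ac)
      qed
      ultimately have "vanishes_to_order n (wt \<nu>) 0"
        unfolding wt_sum
        by (intro vanishes_to_order_mult vanishes_to_order_add[where S = UNIV]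
            vanishes_to_order_sum[where S = UNIV] vanishes_to_order_cnj char_span_add
            char_span_sum span_h char_span_UNIV_cnj span_f
            char_span_chr UNIV_I)
      moreover have "char_span UNIV (wt \<nu>)"
        using trig_wt[OF \<nu>] char_span_UNIV by (auto simp: trig_poly_iff_char_span)
      ultimately show ?thesis
        using vanishes_to_order_iff_multi_deriv unfolding vanishing_moments_def by blast
    qed
    ultimately show ?thesis by blast
  qed
  ultimately show ?thesis by blast
qed

end
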